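(* Let $W_4$ be a $4$-web on a two-dimensional manifold $M$, represented by $\omega_1=-f_x\,dx$, $\omega_2=-f_y\,dy$, $\omega_3=df$, $\omega_4=-(a\,\omega_1+\omega_2)$, with basic invariant $a$ and curvature $K$. Then the linearizability conditions $I_1^0(f,a)=I_2^0(f,a)=0$ are equivalent to the following two equations: $$\begin{aligned} K_{1}={}&\frac{1}{a-a^{2}}\Bigl[\tfrac13\bigl((1-a)a_{1}+aa_{2}\bigr)K-a_{111}+(2+a)a_{112}-2aa_{122}\Bigr]\\ &+\frac{1}{(a-a^{2})^{2}}\Bigl\{[(4-6a)a_{1}+(a^{2}+3a-2)a_{2}]a_{11}+[(2a^{2}+7a-6)a_{1}+(2a-3a^{2})a_{2}]a_{12}+[2(a-a^{2})a_{1}-2a^{2}a_{2}]a_{22}\Bigr\}\\ &+\frac{1}{(a-a^{2})^{3}}\Bigl[(-6a^{2}+8a-3)(a_{1})^{3}-2a^{3}(a_{2})^{3}+(2a^{3}+9a^{2}-15a+6)(a_{1})^{2}a_{2}+(-3a^{3}+6a^{2}-2a)a_{1}(a_{2})^{2}\Bigr] \end{aligned}$$ and $$\begin{aligned} K_{2}={}&\frac{1}{a-a^{2}}\Bigl[\tfrac13\bigl(a_{1}+(a-1)a_{2}\bigr)K+2a_{112}-(2a+1)a_{122}+aa_{222}\Bigr]\\ &+\frac{1}{(a-a^{2})^{2}}\Bigl\{[2a_{1}+(2a-2)a_{2}]a_{11}+[(6a-5)a_{1}+(-2a^{2}-3a+2)a_{2}]a_{12}+[(1-a-2a^{2})a_{1}+2a^{2}a_{2}]a_{22}\Bigr\}\\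 &+\frac{1}{(a-a^{2})^{3}}\Bigl[(4a-2)(a_{1})^{3}+a^{3}(a_{2})^{3}+(6a^{2}-12a+5)(a_{1})^{2}a_{2}+(-2a^{3}-3a^{2}+5a-2)a_{1}(a_{2})^{2}\Bigr]. \end{aligned}$$
   Context: All objects are smooth and the considerations are local: $M$ is a simply connected domain in $\mathbb R^2$ with coordinates $x,y$. A $4$-web on $M$ is given by four differential $1$-forms, any two linearly independent at every point; one can choose coordinates and normalize the forms so that $\omega_1=-f_x\,dx$, $\omega_2=-f_y\,dy$, $\omega_3=df$ with $f_x,f_y\neq0$, and $\omega_4+a\omega_1+\omega_2=0$ for a function $a$ (the basic invariant) taking neither the value $0$ nor $1$. Notation: $$\partial_1=-\frac1{f_x}\frac{\partial}{\partial x},\qquad \partial_2=-\frac1{f_y}\frac{\partial}{\partial y},\qquad H=\frac{f_{xy}}{f_xf_y},\qquad K=\partial_1(H)-\partial_2(H)\ \text{(web curvature)}.$$ For a smooth function $\mu$ put $$I_1(\mu)=-\partial_1^2(\mu)+2\partial_1\partial_2(\mu)+(\mu+H)\partial_1(\mu)-2(2H+\mu)\partial_2(\mu)+H\mu^2+(2H^2-\partial_2(H))\mu-\partial_1(K)+2HK,$$ $$I_2(\mu)=-\partial_2^2(\mu)+2\partial_1\partial_2(\mu)+2(\mu-H)\partial_1(\mu)-(H+\mu)\partial_2(\mu)-H\mu^2+(2H^2-\partial_1(H))\mu-\partial_2(K)+2HK,$$ where $\partial_1\partial_2(\mu)=\partial_1(\partial_2(\mu))$, and $$I_i^0(f,a)=I_i\!\left(\frac{\partial_1(a)-a\,\partial_2(a)}{a-a^2}\right),\quad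 i=1,2.$$ Covariant derivatives: for an integer $k\ge0$ and a function $u$, $\delta_i^{(k)}(u)=\partial_i(u)-kHu$, $i=1,2$. Put $K_i=\delta_i^{(2)}(K)$, $a_i=\delta_i^{(0)}(a)=\partial_i(a)$, $a_{ij}=\delta_j^{(1)}\circ\delta_i^{(0)}(a)$ (one has $a_{12}=a_{21}$), $\widetilde a_{ijk}=\delta_k^{(2)}\circ\delta_j^{(1)}\circ\delta_i^{(0)}(a)$. The symmetrized third covariant derivatives are $$a_{111}=\widetilde a_{111},\quad a_{222}=\widetilde a_{222},\quad a_{112}=\tfrac13(\widetilde a_{112}+\widetilde a_{121}+\widetilde a_{211}),\quad a_{122}=\tfrac13(\widetilde a_{122}+\widetilde a_{212}+\widetilde a_{221}).$$ *)

theory Defs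
  imports "HOL-Analysis.Analysis"
begin

type_synonym scalar_field = "real \<times> real \<Rightarrow> real"

definition pd_x :: "scalar_field \<Rightarrow> scalar_field" where
  "pd_x u p = deriv (\<lambda>t. u (t, snd p)) (fst p)"

definition pd_y :: "scalar_field \<Rightarrow> scalar_field" where
  "pd_y u p = deriv (\<lambda>t. u (fst p, t)) (snd p)"

text \<open>The next two notions are meant for open \<open>M\<close>.  Total differentiability is
  required at every stage, since \<open>deriv\<close> is also defined (arbitrarily) where the
  derivative does not exist.\<close>

primrec Ck_on :: "nat \<Rightarrow> scalar_field \<Rightarrow> (real \<times> real) set \<Rightarrow> bool" where
  "Ck_on 0 u M \<longleftrightarrow> continuous_on M u"
| "Ck_on (Suc k) u M \<longleftrightarrow>
     u differentiable_on M \<and> Ck_on k (pd_x u) M \<and> Ck_on k (pd_y u) M"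

definition smooth_field :: "scalar_field \<Rightarrow> (real \<times> real) set \<Rightarrow> bool" where
  "smooth_field u M \<longleftrightarrow> (\<forall>k. Ck_on k u M)"

text \<open>A 1-form \<open>P dx + Q dy\<close> is encoded by its coefficient pair \<open>p \<mapsto> (P p, Q p)\<close>.\<close>

type_synonym one_form = "real \<times> real \<Rightarrow> real \<times> real"

definition form_dx :: one_form where "form_dx p = (1, 0)"

definition form_dy :: one_form where "form_dy p = (0, 1)"

definition form_d :: "scalar_field \<Rightarrow> one_form" where
  "form_d u p = pd_x u p *\<^sub>R form_dx p + pd_y u p *\<^sub>R form_dy p"

definition smooth_form :: "one_form \<Rightarrow> (real \<times> real) set \<Rightarrow> bool" where
  "smooth_form \<omega> M \<longleftrightarrow> smooth_field (\<lambda>p. fst (\<omega> p)) M \<and> smooth_field (\<lambda>p. snd (\<omega> p)) M"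

text \<open>The condition \<open>\<omega> i p \<noteq> \<omega> j p\<close> is needed because \<open>{v, v}\<close> is a singleton, which is
  independent as a set when \<open>v \<noteq> 0\<close>.\<close>

definition four_web :: "(nat \<Rightarrow> one_form) \<Rightarrow> (real \<times> real) set \<Rightarrow> bool" where
  "four_web \<omega> M \<longleftrightarrow>
     (\<forall>i\<in>{1..4}. smooth_form (\<omega> i) M) \<and>
     (\<forall>i\<in>{1..4}. \<forall>j\<in>{1..4}. i \<noteq> j \<longrightarrow>
        (\<forall>p\<in>M. \<omega> i p \<noteq> \<omega> j p \<and> independent {\<omega> i p, \<omega> j p}))"

text \<open>In \<open>web_pd f i\<close> and \<open>web_delta f i k\<close> the index \<open>i\<close> is \<open>1\<close> or \<open>2\<close>.\<close>

definition web_pd :: "scalar_field \<Rightarrow> nat \<Rightarrow> scalar_field \<Rightarrow> scalar_field" where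
  "web_pd f i u p = (if i = 1 then - (1 / pd_x f p) * pd_x u p
                     else - (1 / pd_y f p) * pd_y u p)"

definition web_H :: "scalar_field \<Rightarrow> scalar_field" where
  "web_H f p = pd_y (pd_x f) p / (pd_x f p * pd_y f p)"

definition web_K :: "scalar_field \<Rightarrow> scalar_field" where
  "web_K f p = web_pd f 1 (web_H f) p - web_pd f 2 (web_H f) p"

definition web_I1 :: "scalar_field \<Rightarrow> scalar_field \<Rightarrow> scalar_field" where
  "web_I1 f \<mu> p =
     - web_pd f 1 (web_pd f 1 \<mu>) p + 2 * web_pd f 1 (web_pd f 2 \<mu>) p
     + (\<mu> p + web_H f p) * web_pd f 1 \<mu> p
     - 2 * (2 * web_H f p + \<mu> p) * web_pd f 2 \<mu> p
     + web_H f p * (\<mu> p)\<^sup>2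
     + (2 * (web_H f p)\<^sup>2 - web_pd f 2 (web_H f) p) * \<mu> p
     - web_pd f 1 (web_K f) p + 2 * web_H f p * web_K f p"

definition web_I2 :: "scalar_field \<Rightarrow> scalar_field \<Rightarrow> scalar_field" where
  "web_I2 f \<mu> p =
     - web_pd f 2 (web_pd f 2 \<mu>) p + 2 * web_pd f 1 (web_pd f 2 \<mu>) p
     + 2 * (\<mu> p - web_H f p) * web_pd f 1 \<mu> p
     - (web_H f p + \<mu> p) * web_pd f 2 \<mu> p
     - web_H f p * (\<mu> p)\<^sup>2
     + (2 * (web_H f p)\<^sup>2 - web_pd f 1 (web_H f) p) * \<mu> p
     - web_pd f 2 (web_K f) p + 2 * web_H f p * web_K f p"

definition web_mu0 :: "scalar_field \<Rightarrow> scalar_field \<Rightarrow> scalar_field" where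
  "web_mu0 f a p = (web_pd f 1 a p - a p * web_pd f 2 a p) / (a p - (a p)\<^sup>2)"

definition web_I1_0 :: "scalar_field \<Rightarrow> scalar_field \<Rightarrow> scalar_field" where
  "web_I1_0 f a = web_I1 f (web_mu0 f a)"

definition web_I2_0 :: "scalar_field \<Rightarrow> scalar_field \<Rightarrow> scalar_field" where
  "web_I2_0 f a = web_I2 f (web_mu0 f a)"

definition web_delta :: "scalar_field \<Rightarrow> nat \<Rightarrow> nat \<Rightarrow> scalar_field \<Rightarrow> scalar_field" where
  "web_delta f i k u p = web_pd f i u p - real k * web_H f p * u p"

definition cov_K :: "scalar_field \<Rightarrow> nat \<Rightarrow> scalar_field" where
  "cov_K f i = web_delta f i 2 (web_K f)"

definition cov1 :: "scalar_field \<Rightarrow> scalar_field \<Rightarrow> nat \<Rightarrow> scalar_field" where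
  "cov1 f a i = web_delta f i 0 a"

definition cov2 :: "scalar_field \<Rightarrow> scalar_field \<Rightarrow> nat \<Rightarrow> nat \<Rightarrow> scalar_field" where
  "cov2 f a i j = (web_delta f j 1 \<circ> web_delta f i 0) a"

definition cov3 :: "scalar_field \<Rightarrow> scalar_field \<Rightarrow> nat \<Rightarrow> nat \<Rightarrow> nat \<Rightarrow> scalar_field" where
  "cov3 f a i j k = (web_delta f k 2 \<circ> web_delta f j 1 \<circ> web_delta f i 0) a"

definition sym111 :: "scalar_field \<Rightarrow> scalar_field \<Rightarrow> scalar_field" where
  "sym111 f a p = cov3 f a 1 1 1 p"

definition sym112 :: "scalar_field \<Rightarrow> scalar_field \<Rightarrow> scalar_field" where
  "sym112 f a p = 1 / 3 * (cov3 f a 1 1 2 p + cov3 f a 1 2 1 p + cov3 f a 2 1 1 p)"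

definition sym122 :: "scalar_field \<Rightarrow> scalar_field \<Rightarrow> scalar_field" where
  "sym122 f a p = 1 / 3 * (cov3 f a 1 2 2 p + cov3 f a 2 1 2 p + cov3 f a 2 2 1 p)"

definition sym222 :: "scalar_field \<Rightarrow> scalar_field \<Rightarrow> scalar_field" where
  "sym222 f a p = cov3 f a 2 2 2 p"

end

(* On M the derivations d_1, d_2 satisfy [d_1, d_2] = H (d_2 - d_1), so all derivatives of a can be
   brought to a normal order. In these jets of a, H and h_i = d_i H, with 1 / (a - a^2) adjoined, both
   I_i(mu_0) and the right-hand side of the equation for K_i are polynomials. The derivatives of K
   occur in I_i only as - d_i K + 2 H K = - K_i and need no expansion; the remaining terms of
   I_i(mu_0) equal the right-hand side for K_i. Hence I_i^0 = (right-hand side) - K_i at every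
   point, and each condition is equivalent to one equation. *)

theory Submission
  imports Defs
begin

section \<open>Smooth fields\<close>

text \<open>Chain rule along the horizontal line t -> (t, y). Total differentiability of
  \<open>u\<close> makes \<open>pd_x u\<close> a genuine derivative, where \<open>deriv\<close>
  alone could be an arbitrary value.\<close>

lemma pd_x_DERIV:
  assumes "u differentiable (at (x, y))"
  shows "((\<lambda>t. u (t, y)) has_real_derivative pd_x u (x, y)) (at x)"
proof -
  have "(\<lambda>t. (t, y)) differentiable (at x)"
    unfolding differentiable_def by (rule exI) (rule derivative_intros)+
  then have "(u \<circ> (\<lambda>t. (t, y))) differentiable (at x)"
    using assms by (intro differentiable_chain_at) simp_all
  then show ?thesis
    by (simp add: pd_x_def DERIV_deriv_iff_real_differentiable o_def)
qed

lemma pd_y_DERIV: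
  assumes "u differentiable (at (x, y))"
  shows "((\<lambda>t. u (x, t)) has_real_derivative pd_y u (x, y)) (at y)"
proof -
  have "(\<lambda>t. (x, t)) differentiable (at y)"
    unfolding differentiable_def by (rule exI) (rule derivative_intros)+
  then have "(u \<circ> (\<lambda>t. (x, t))) differentiable (at y)"
    using assms by (intro differentiable_chain_at) simp_all
  then show ?thesis
    by (simp add: pd_y_def DERIV_deriv_iff_real_differentiable o_def)
qed

text \<open>\<open>deriv\<close> depends only on the germ of a function. An open box around
  \<open>p\<close> inside \<open>M\<close> makes \<open>u\<close> and \<open>v\<close> agree near
  \<open>p\<close> along both coordinate lines.\<close>

lemma pd_cong:
  assumes "open M" "p \<in> M" "\<And>q. q \<in> M \<Longrightarrow> u q = v q"
  shows "pd_x u p = pd_x v p" "pd_y u p = pd_y v p"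
proof -
  obtain X Y where XY: "open X" "open Y" "fst p \<in> X" "snd p \<in> Y" "X \<times> Y \<subseteq> M"
    using assms(1,2) by (metis mem_Times_iff open_prod_elim)
  have "eventually (\<lambda>t. t \<in> X) (nhds (fst p))" "eventually (\<lambda>t. t \<in> Y) (nhds (snd p))"
    using XY eventually_nhds by blast+
  then have "eventually (\<lambda>t. u (t, snd p) = v (t, snd p)) (nhds (fst p))"
    "eventually (\<lambda>t. u (fst p, t) = v (fst p, t)) (nhds (snd p))"
    using XY assms(3) by (auto elim!: eventually_mono)
  then show "pd_x u p = pd_x v p" "pd_y u p = pd_y v p"
    unfolding pd_x_def pd_y_def by (simp_all cong: deriv_cong_ev)
qed

text \<open>Supplies the side condition of the simp rules for \<open>deriv\<close> of sums, products
  and quotients.\<close>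

lemma section_field_differentiable:
  fixes u :: scalar_field
  assumes "u differentiable (at p)"
  shows "(\<lambda>t. u (t, snd p)) field_differentiable (at (fst p))"
    and "(\<lambda>t. u (fst p, t)) field_differentiable (at (snd p))"
  using pd_x_DERIV[of u "fst p" "snd p"] pd_y_DERIV[of u "fst p" "snd p"] assms
  by (auto simp: field_differentiable_def)

section \<open>Arithmetic rules for partial derivatives\<close>

lemma pd_add:
  assumes "u differentiable (at p)" "v differentiable (at p)"
  shows "pd_x (\<lambda>q. u q + v q) p = pd_x u p + pd_x v p"
    and "pd_y (\<lambda>q. u q + v q) p = pd_y u p + pd_y v p"
  unfolding pd_x_def pd_y_def
  by (simp_all add: assms section_field_differentiable)

lemma pd_diff:
  assumes "u differentiable (at p)" "v differentiable (at p)"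
  shows "pd_x (\<lambda>q. u q - v q) p = pd_x u p - pd_x v p"
    and "pd_y (\<lambda>q. u q - v q) p = pd_y u p - pd_y v p"
  unfolding pd_x_def pd_y_def
  by (simp_all add: assms section_field_differentiable)

lemma pd_mult:
  assumes "u differentiable (at p)" "v differentiable (at p)"
  shows "pd_x (\<lambda>q. u q * v q) p = pd_x u p * v p + u p * pd_x v p"
    and "pd_y (\<lambda>q. u q * v q) p = pd_y u p * v p + u p * pd_y v p"
  unfolding pd_x_def pd_y_def
  by (simp_all add: assms section_field_differentiable)

lemma pd_divide:
  assumes "u differentiable (at p)" "v differentiable (at p)" "v p \<noteq> 0"
  shows "pd_x (\<lambda>q. u q / v q) p = (pd_x u p * v p - u p * pd_x v p) / (v p)\<^sup>2"
    and "pd_y (\<lambda>q. u q / v q) p = (pd_y u p * v p - u p * pd_y v p) / (v p)\<^sup>2"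
  unfolding pd_x_def pd_y_def
  by (simp_all add: assms section_field_differentiable)

lemma pd_const: "pd_x (\<lambda>_. c) = (\<lambda>_. 0)" "pd_y (\<lambda>_. c) = (\<lambda>_. 0)"
  by (auto simp: pd_x_def pd_y_def)

text \<open>The sum, product and quotient rules are available only at points of \<open>M\<close>, so
  they do not give equal functions on the whole plane. This lemma transfers regularity along such
  equations. The induction generalizes \<open>u\<close> and \<open>v\<close> because it passes to
  their partial derivatives.\<close>

lemma Ck_on_cong:
  assumes "open M" "\<And>p. p \<in> M \<Longrightarrow> u p = v p"
  shows "Ck_on k u M \<longleftrightarrow> Ck_on k v M"
  using assms(2)
proof (induction k arbitrary: u v)
  case 0
  then show ?case by (simp cong: continuous_on_cong)
next
  case (Suc k)
  have transfer: "w' differentiable_on M"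
    if "w differentiable_on M" "\<And>p. p \<in> M \<Longrightarrow> w p = w' p" for w w' :: scalar_field
    unfolding differentiable_on_def
  proof
    fix p assume p: "p \<in> M"
    show "w' differentiable (at p within M)"
      \<comment> \<open>The radius 1 is arbitrary: \<open>w\<close> and \<open>w'\<close> agree on
        all of \<open>M\<close>, and differentiability within \<open>M\<close> looks at nothing
        else.\<close>
      by (rule differentiable_transform_within[of w _ _ 1])
        (use that p in \<open>auto simp: differentiable_on_def\<close>)
  qed
  have "u differentiable_on M \<longleftrightarrow> v differentiable_on M"
    using transfer[of u v] transfer[of v u] Suc.prems by auto
  moreover have "Ck_on k (pd_x u) M \<longleftrightarrow> Ck_on k (pd_x v) M"
    by (intro Suc.IH pd_cong[OF assms(1)] Suc.prems)
  moreover have "Ck_on k (pd_y u) M \<longleftrightarrow> Ck_on k (pd_y v) M"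
    by (intro Suc.IH pd_cong[OF assms(1)] Suc.prems)
  ultimately show ?case by simp
qed

text \<open>Needed for the Leibniz rule, where one factor stays undifferentiated and has to count as
  a field of one order less.\<close>

lemma Ck_on_SucD: "Ck_on (Suc k) u M \<Longrightarrow> Ck_on k u M"
proof (induction k arbitrary: u)
  case 0
  then show ?case by (simp add: differentiable_imp_continuous_on)
next
  case (Suc k)
  from Suc.prems have "u differentiable_on M" "Ck_on k (pd_x u) M" "Ck_on k (pd_y u) M"
    using Suc.IH[of "pd_x u"] Suc.IH[of "pd_y u"] by (simp_all del: Suc.IH)
  then show ?case by simp
qed

section \<open>Closure of C^k fields under arithmetic\<close>

lemma Ck_on_const: "Ck_on k (\<lambda>_. c) M"
proof (induction k arbitrary: c)
  case (Suc k)
  then show ?case by (simp add: pd_const)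
qed simp

lemma Ck_on_add:
  assumes "open M" "Ck_on k u M" "Ck_on k v M"
  shows "Ck_on k (\<lambda>p. u p + v p) M"
  using assms(2,3)
proof (induction k arbitrary: u v)
  case (Suc k)
  have d: "u differentiable (at p)" "v differentiable (at p)" if "p \<in> M" for p
    using Suc.prems that assms(1) by (simp_all add: differentiable_on_eq_differentiable_at)
  have "Ck_on k (\<lambda>p. pd_x u p + pd_x v p) M" "Ck_on k (\<lambda>p. pd_y u p + pd_y v p) M"
    using Suc by simp_all
  then have "Ck_on k (pd_x (\<lambda>p. u p + v p)) M" "Ck_on k (pd_y (\<lambda>p. u p + v p)) M"
    by (simp_all only: Ck_on_cong[OF assms(1) pd_add(1)[OF d]] Ck_on_cong[OF assms(1) pd_add(2)[OF d]])
  with Suc.prems show ?case by (simp add: differentiable_on_add)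
qed (simp add: continuous_on_add)

lemma Ck_on_mult:
  assumes "open M" "Ck_on k u M" "Ck_on k v M"
  shows "Ck_on k (\<lambda>p. u p * v p) M"
  using assms(2,3)
proof (induction k arbitrary: u v)
  case (Suc k)
  have d: "u differentiable (at p)" "v differentiable (at p)" if "p \<in> M" for p
    using Suc.prems that assms(1) by (simp_all add: differentiable_on_eq_differentiable_at)
  have "Ck_on k u M" "Ck_on k v M" using Suc.prems by (auto intro: Ck_on_SucD)
  then have "Ck_on k (\<lambda>p. pd_x u p * v p + u p * pd_x v p) M"
    "Ck_on k (\<lambda>p. pd_y u p * v p + u p * pd_y v p) M"
    using Suc by (simp_all add: Ck_on_add[OF assms(1)])
  then have "Ck_on k (pd_x (\<lambda>p. u p * v p)) M" "Ck_on k (pd_y (\<lambda>p. u p * v p)) M"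
    by (simp_all only: Ck_on_cong[OF assms(1) pd_mult(1)[OF d]] Ck_on_cong[OF assms(1) pd_mult(2)[OF d]])
  with Suc.prems show ?case by (simp add: differentiable_on_mult)
qed (simp add: continuous_on_mult)

text \<open>The derivative of 1/u is -u' (1/u)^2, which involves 1/u again but only to order
  \<open>k\<close>. The induction hypothesis for the same \<open>u\<close> and closure under
  products therefore suffice.\<close>

lemma Ck_on_inverse:
  assumes "open M" "Ck_on k u M" "\<And>p. p \<in> M \<Longrightarrow> u p \<noteq> 0"
  shows "Ck_on k (\<lambda>p. inverse (u p)) M"
  using assms(2)
proof (induction k)
  case (Suc k)
  let ?v = "\<lambda>p. inverse (u p)"
  have d: "u differentiable (at p)" if "p \<in> M" for p
    using Suc.prems that assms(1) by (simp add: differentiable_on_eq_differentiable_at)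
  have v: "Ck_on k ?v M" using Suc Ck_on_SucD by blast
  \<comment> \<open>Negation is written as \<open>- 1 *\<close>, so that the rules for products and
    constants cover it.\<close>
  have "Ck_on k (\<lambda>p. (- 1 * pd_x u p) * (?v p * ?v p)) M"
    "Ck_on k (\<lambda>p. (- 1 * pd_y u p) * (?v p * ?v p)) M"
    using Suc.prems by (intro Ck_on_mult[OF assms(1)] Ck_on_const v; simp)+
  moreover have eq: "(- 1 * pd_x u p) * (?v p * ?v p) = pd_x ?v p"
    "(- 1 * pd_y u p) * (?v p * ?v p) = pd_y ?v p" if "p \<in> M" for p
    using pd_divide[of "\<lambda>_. 1" p u, OF _ d[OF that] assms(3)[OF that]]
    by (simp_all add: pd_const divide_inverse power2_eq_square)
  ultimately have "Ck_on k (pd_x ?v) M" "Ck_on k (pd_y ?v) M"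
    by (simp_all only: Ck_on_cong[OF assms(1) eq(1)] Ck_on_cong[OF assms(1) eq(2)])
  moreover have "?v differentiable_on M"
    using Suc.prems assms(1,3) d
    by (simp add: differentiable_on_eq_differentiable_at Deriv.differentiable_inverse)
  ultimately show ?case by simp
next
  case 0
  then show ?case using assms(3) by (auto intro: continuous_on_inverse)
qed

section \<open>Passage from C^k to smooth fields\<close>

lemma smooth_field_differentiable:
  "open M \<Longrightarrow> smooth_field u M \<Longrightarrow> p \<in> M \<Longrightarrow> u differentiable (at p)"
  using differentiable_on_eq_differentiable_at unfolding smooth_field_def
  by (metis Ck_on.simps(2))

lemma smooth_field_continuous: "smooth_field u M \<Longrightarrow> continuous_on M u"
  unfolding smooth_field_def by (metis Ck_on.simps(1))

lemma smooth_field_pd: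
  assumes "smooth_field u M"
  shows "smooth_field (pd_x u) M" "smooth_field (pd_y u) M"
  using assms unfolding smooth_field_def by (metis Ck_on.simps(2))+

lemma smooth_field_const: "smooth_field (\<lambda>_. c) M"
  by (simp add: smooth_field_def Ck_on_const)

lemma smooth_field_add:
  "open M \<Longrightarrow> smooth_field u M \<Longrightarrow> smooth_field v M \<Longrightarrow> smooth_field (\<lambda>p. u p + v p) M"
  by (simp add: smooth_field_def Ck_on_add)

lemma smooth_field_mult:
  "open M \<Longrightarrow> smooth_field u M \<Longrightarrow> smooth_field v M \<Longrightarrow> smooth_field (\<lambda>p. u p * v p) M"
  by (simp add: smooth_field_def Ck_on_mult)

lemma smooth_field_diff:
  assumes "open M" "smooth_field u M" "smooth_field v M"
  shows "smooth_field (\<lambda>p. u p - v p) M"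
  using smooth_field_add[OF assms(1,2) smooth_field_mult[OF assms(1) smooth_field_const[of "-1"] assms(3)]]
  by simp

lemma smooth_field_divide:
  assumes "open M" "smooth_field u M" "smooth_field v M" "\<And>p. p \<in> M \<Longrightarrow> v p \<noteq> 0"
  shows "smooth_field (\<lambda>p. u p / v p) M"
  using assms by (simp add: smooth_field_def divide_inverse Ck_on_mult Ck_on_inverse)

section \<open>Symmetry of second derivatives\<close>

text \<open>Two applications of the mean value theorem: first in \<open>s\<close> to
  \<open>F s (y+h) - F s y\<close>, then in \<open>t\<close> to \<open>Fx s\<close> at the
  intermediate point found. The second difference is symmetric in the two variables, so it can be
  compared with either mixed derivative.\<close>

lemma second_difference_mvt:
  fixes F Fx Fxy :: "real \<Rightarrow> real \<Rightarrow> real"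
  assumes "h > 0"
    and Fx: "\<And>s t. s \<in> {x..x+h} \<Longrightarrow> t \<in> {y..y+h} \<Longrightarrow> ((\<lambda>s. F s t) has_real_derivative Fx s t) (at s)"
    and Fxy: "\<And>s t. s \<in> {x..x+h} \<Longrightarrow> t \<in> {y..y+h} \<Longrightarrow> (Fx s has_real_derivative Fxy s t) (at t)"
  obtains s t where "s \<in> {x..x+h}" "t \<in> {y..y+h}"
    "F (x+h) (y+h) - F (x+h) y - F x (y+h) + F x y = h\<^sup>2 * Fxy s t"
proof -
  have "((\<lambda>s. F s (y+h) - F s y) has_real_derivative Fx s (y+h) - Fx s y) (at s)"
    if "x \<le> s" "s \<le> x+h" for s
    using that \<open>h > 0\<close> by (intro derivative_intros Fx) auto
  from MVT2[of x "x+h", OF _ this] \<open>h > 0\<close> obtain s where s: "x < s" "s < x+h"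
    and "F (x+h) (y+h) - F (x+h) y - (F x (y+h) - F x y) = h * (Fx s (y+h) - Fx s y)"
    by auto
  moreover have "(Fx s has_real_derivative Fxy s t) (at t)" if "y \<le> t" "t \<le> y+h" for t
    using that s by (intro Fxy) auto
  from MVT2[of y "y+h", OF _ this] \<open>h > 0\<close> obtain t where "y < t" "t < y+h"
    and "Fx s (y+h) - Fx s y = h * Fxy s t"
    by auto
  ultimately show ?thesis
    using that[of s t] by (simp add: power2_eq_square algebra_simps)
qed

text \<open>Schwarz's theorem. One second difference over a small square equals
  \<open>h\<^sup>2\<close> times each mixed derivative at some point of the square; continuity
  brings both values close to those at \<open>p\<close>.\<close>

lemma pd_commute:
  assumes "open M" "p \<in> M" "smooth_field u M"
  shows "pd_x (pd_y u) p = pd_y (pd_x u) p"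
proof (rule ccontr)
  assume neq: "pd_x (pd_y u) p \<noteq> pd_y (pd_x u) p"
  \<comment> \<open>Half the supposed gap: two errors, each below \<open>e\<close>, cannot bridge
    it.\<close>
  define e where "e = \<bar>pd_x (pd_y u) p - pd_y (pd_x u) p\<bar> / 2"
  have "e > 0" using neq by (simp add: e_def)
  have sm: "smooth_field (pd_x u) M" "smooth_field (pd_y u) M"
    "smooth_field (pd_x (pd_y u)) M" "smooth_field (pd_y (pd_x u)) M"
    using assms(3) by (auto intro: smooth_field_pd)
  have near: "eventually (\<lambda>q. dist (v q) (v p) < e) (nhds p)" if "smooth_field v M" for v
  proof -
    have "isCont v p"
      using that assms smooth_field_continuous continuous_on_eq_continuous_at by blast
    then have "(v \<longlongrightarrow> v p) (nhds p)" by (simp add: isCont_def tendsto_at_iff_tendsto_nhds)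
    then show ?thesis using \<open>e > 0\<close> tendstoD by blast
  qed
  have "eventually (\<lambda>q. q \<in> M) (nhds p)" using assms eventually_nhds by blast
  with near[OF sm(3)] near[OF sm(4)]
  have "eventually (\<lambda>q. q \<in> M \<and> dist (pd_x (pd_y u) q) (pd_x (pd_y u) p) < e
     \<and> dist (pd_y (pd_x u) q) (pd_y (pd_x u) p) < e) (nhds p)"
    by eventually_elim simp
  then obtain S where S: "open S" "p \<in> S" and
    SM: "\<And>q. q \<in> S \<Longrightarrow> q \<in> M" and
    Sx: "\<And>q. q \<in> S \<Longrightarrow> dist (pd_x (pd_y u) q) (pd_x (pd_y u) p) < e" and
    Sy: "\<And>q. q \<in> S \<Longrightarrow> dist (pd_y (pd_x u) q) (pd_y (pd_x u) p) < e"
    unfolding eventually_nhds by blast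
  obtain x y where p: "p = (x, y)" by (cases p)
  obtain X Y where XY: "open X" "open Y" "x \<in> X" "y \<in> Y" "X \<times> Y \<subseteq> S"
    using S p by (metis mem_Sigma_iff open_prod_elim)
  obtain d1 d2 where d: "d1 > 0" "cball x d1 \<subseteq> X" "d2 > 0" "cball y d2 \<subseteq> Y"
    using XY open_contains_cball by metis
  \<comment> \<open>The closed square with lower left corner \<open>p\<close> and side
    \<open>h\<close> then stays inside \<open>X \<times> Y\<close>, hence inside
    \<open>S\<close>.\<close>
  define h where "h = min d1 d2"
  have h: "h > 0" using d by (simp add: h_def)
  have box: "(s, t) \<in> S" if "s \<in> {x..x+h}" "t \<in> {y..y+h}" for s t
  proof -
    have "s \<in> cball x d1" "t \<in> cball y d2" using that by (auto simp: h_def dist_real_def)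
    then show ?thesis using d XY by blast
  qed
  have diff: "v differentiable (at q)" if "smooth_field v M" "q \<in> S" for v q
    using smooth_field_differentiable[OF assms(1)] that SM by blast
  obtain s t where st: "s \<in> {x..x+h}" "t \<in> {y..y+h}" "u (x+h, y+h) - u (x+h, y) - u (x, y+h) + u (x, y)
      = h\<^sup>2 * pd_y (pd_x u) (s, t)"
    by (rule second_difference_mvt[of h x y "\<lambda>s t. u (s, t)" "\<lambda>s t. pd_x u (s, t)"
        "\<lambda>s t. pd_y (pd_x u) (s, t)"])
      (auto intro!: h pd_x_DERIV pd_y_DERIV diff assms(3) sm box)
  \<comment> \<open>The same lemma with the variables exchanged; only the two middle terms of the
    second difference change places.\<close>
  obtain t' s' where st': "t' \<in> {y..y+h}" "s' \<in> {x..x+h}" "u (x+h, y+h) - u (x, y+h) - u (x+h, y) + u (x, y)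
      = h\<^sup>2 * pd_x (pd_y u) (s', t')"
    by (rule second_difference_mvt[of h y x "\<lambda>t s. u (s, t)" "\<lambda>t s. pd_y u (s, t)"
        "\<lambda>t s. pd_x (pd_y u) (s, t)"])
      (auto intro!: h pd_x_DERIV pd_y_DERIV diff assms(3) sm box)
  have "h\<^sup>2 * pd_y (pd_x u) (s, t) = h\<^sup>2 * pd_x (pd_y u) (s', t')"
    using st(3) st'(3) by linarith
  then have "pd_y (pd_x u) (s, t) = pd_x (pd_y u) (s', t')" using h by simp
  then have "\<bar>pd_x (pd_y u) p - pd_y (pd_x u) p\<bar>
      \<le> \<bar>pd_y (pd_x u) (s, t) - pd_y (pd_x u) p\<bar> + \<bar>pd_x (pd_y u) (s', t') - pd_x (pd_y u) p\<bar>"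
    by simp
  also have "\<dots> < e + e"
    using Sy[OF box[OF st(1,2)]] Sx[OF box[OF st'(2,1)]] by (simp add: dist_real_def)
  finally show False by (simp add: e_def)
qed

section \<open>The polynomial identities\<close>

text \<open>Takes real numbers instead of fields, so that the comparison becomes an algebraic
  identity between values at one point. The body repeats the formula of the theorem, so unfolding it
  at the end is enough.\<close>

definition K1_rhs ::
  "real \<Rightarrow> real \<Rightarrow> real \<Rightarrow> real \<Rightarrow> real \<Rightarrow> real \<Rightarrow> real
    \<Rightarrow> real \<Rightarrow> real \<Rightarrow> real \<Rightarrow> real" where
  "K1_rhs A K a1 a2 a11 a12 a22 a111 a112 a122 =
     1 / (A - A^2) *
       (1/3 * ((1 - A) * a1 + A * a2) * K - a111 + (2 + A) * a112 - 2 * A * a122)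
     + 1 / (A - A^2)^2 *
       (((4 - 6 * A) * a1 + (A^2 + 3 * A - 2) * a2) * a11
        + ((2 * A^2 + 7 * A - 6) * a1 + (2 * A - 3 * A^2) * a2) * a12
        + (2 * (A - A^2) * a1 - 2 * A^2 * a2) * a22)
     + 1 / (A - A^2)^3 *
       ((- 6 * A^2 + 8 * A - 3) * a1^3 - 2 * A^3 * a2^3
        + (2 * A^3 + 9 * A^2 - 15 * A + 6) * a1^2 * a2
        + (- 3 * A^3 + 6 * A^2 - 2 * A) * a1 * a2^2)"

definition K2_rhs ::
  "real \<Rightarrow> real \<Rightarrow> real \<Rightarrow> real \<Rightarrow> real \<Rightarrow> real \<Rightarrow> real
    \<Rightarrow> real \<Rightarrow> real \<Rightarrow> real \<Rightarrow> real" where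
  "K2_rhs A K a1 a2 a11 a12 a22 a112 a122 a222 =
     1 / (A - A^2) *
       (1/3 * (a1 + (A - 1) * a2) * K + 2 * a112 - (2 * A + 1) * a122 + A * a222)
     + 1 / (A - A^2)^2 *
       ((2 * a1 + (2 * A - 2) * a2) * a11
        + ((6 * A - 5) * a1 + (- 2 * A^2 - 3 * A + 2) * a2) * a12
        + ((1 - A - 2 * A^2) * a1 + 2 * A^2 * a2) * a22)
     + 1 / (A - A^2)^3 *
       ((4 * A - 2) * a1^3 + A^3 * a2^3
        + (6 * A^2 - 12 * A + 5) * a1^2 * a2
        + (- 2 * A^3 - 3 * A^2 + 5 * A - 2) * a1 * a2^2)"

text \<open>The variables stand for the values at one point of \<open>P = \<partial>\<^sub>1 a\<close>,
  \<open>Q = \<partial>\<^sub>2 a\<close>, \<open>R = \<partial>\<^sub>1 P\<close>, \<open>S = \<partial>\<^sub>2 P\<close>, \<open>T = \<partial>\<^sub>2 Q\<close>, \<open>Q1 = \<partial>\<^sub>1 Q\<close>, and so on;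
  \<open>m = N / D\<close> is \<open>\<mu>\<close> and \<open>w = 1 / D\<close>. The two digits of \<open>m12\<close>, \<open>N12\<close>, \<open>D12\<close> and \<open>Q12\<close> are read in
  different ways: the first three are \<open>\<partial>\<^sub>1\<partial>\<^sub>2\<close>, while \<open>Q12 = \<partial>\<^sub>2\<partial>\<^sub>1 Q\<close>.\<close>

lemma web_identities:
  fixes A P Q H R S T h1 h2 R1 R2 S2 T2 K :: real
  assumes "w * (A - A^2) = 1" and "K = h1 - h2"
    and Q1: "Q1 = S + H * (Q - P)" and S1: "S1 = R2 + H * (S - R)"
    and Q11: "Q11 = S1 + h1 * (Q - P) + H * (Q1 - R)"
    and Q12: "Q12 = S2 + h2 * (Q - P) + H * (T - S)"
    and T1: "T1 = Q12 + H * (T - Q1)"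
    and D: "D = A - A^2" and N: "N = P - A * Q"
    and D1: "D1 = P - 2 * A * P" and D2: "D2 = Q - 2 * A * Q"
    and D11: "D11 = R - 2 * (P * P + A * R)" and D12: "D12 = Q1 - 2 * (P * Q + A * Q1)"
    and D22: "D22 = T - 2 * (Q * Q + A * T)"
    and N1: "N1 = R - (P * Q + A * Q1)" and N2: "N2 = S - (Q * Q + A * T)"
    and N11: "N11 = R1 - (R * Q + 2 * P * Q1 + A * Q11)"
    and N12: "N12 = S1 - (2 * Q * Q1 + P * T + A * T1)"
    and N22: "N22 = S2 - (3 * Q * T + A * T2)"
    and m: "m = w * N"
    and m1: "m1 = w^2 * (N1 * D - N * D1)"
    and m2: "m2 = w^2 * (N2 * D - N * D2)"
    and m11: "m11 = w^3 * ((N11 * D - N * D11) * D - 2 * (N1 * D - N * D1) * D1)"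
    and m12: "m12 = w^3 * ((N12 * D + N2 * D1 - N1 * D2 - N * D12) * D
        - 2 * (N2 * D - N * D2) * D1)"
    and m22: "m22 = w^3 * ((N22 * D - N * D22) * D - 2 * (N2 * D - N * D2) * D2)"
    and a11: "a11 = R - H * P" and a12: "a12 = S - H * P" and a22: "a22 = T - H * Q"
    and a111: "a111 = R1 - (h1 * P + H * R) - 2 * H * (R - H * P)"
    and a112: "a112 = 1/3 * ((R2 - (h2 * P + H * S) - 2 * H * (R - H * P))
        + (S1 - (h1 * P + H * R) - 2 * H * (S - H * P))
        + (Q11 - (h1 * Q + H * Q1) - 2 * H * (Q1 - H * Q)))"
    and a122: "a122 = 1/3 * ((S2 - (h2 * P + H * S) - 2 * H * (S - H * P))
        + (Q12 - (h2 * Q + H * T) - 2 * H * (Q1 - H * Q))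
        + (T1 - (h1 * Q + H * Q1) - 2 * H * (T - H * Q)))"
    and a222: "a222 = T2 - (h2 * Q + H * T) - 2 * H * (T - H * Q)"
  shows "- m11 + 2 * m12 + (m + H) * m1 - 2 * (2 * H + m) * m2 + H * m^2 + (2 * H^2 - h2) * m
      = K1_rhs A K P Q a11 a12 a22 a111 a112 a122" (is "?L1 = _")
    and "- m22 + 2 * m12 + 2 * (m - H) * m1 - (H + m) * m2 - H * m^2 + (2 * H^2 - h1) * m
      = K2_rhs A K P Q a11 a12 a22 a112 a122 a222" (is "?L2 = _")
proof -
  have W: "1 / (A - A^2) = w" "1 / (A - A^2)^n = w^n" for n
    using assms(1) by (auto simp: divide_eq_eq power_mult_distrib[symmetric])
  let ?X = "1/3 * ((1 - A) * P + A * Q) * K - a111 + (2 + A) * a112 - 2 * A * a122"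
  let ?Y = "((4 - 6 * A) * P + (A^2 + 3 * A - 2) * Q) * a11
       + ((2 * A^2 + 7 * A - 6) * P + (2 * A - 3 * A^2) * Q) * a12
       + (2 * (A - A^2) * P - 2 * A^2 * Q) * a22"
  let ?Z = "(- 6 * A^2 + 8 * A - 3) * P^3 - 2 * A^3 * Q^3
       + (2 * A^3 + 9 * A^2 - 15 * A + 6) * P^2 * Q
       + (- 3 * A^3 + 6 * A^2 - 2 * A) * P * Q^2"
  let ?X' = "1/3 * (P + (A - 1) * Q) * K + 2 * a112 - (2 * A + 1) * a122 + A * a222"
  let ?Y' = "(2 * P + (2 * A - 2) * Q) * a11
       + ((6 * A - 5) * P + (- 2 * A^2 - 3 * A + 2) * Q) * a12
       + ((1 - A - 2 * A^2) * P + 2 * A^2 * Q) * a22"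
  let ?Z' = "(4 * A - 2) * P^3 + A^3 * Q^3
       + (6 * A^2 - 12 * A + 5) * P^2 * Q
       + (- 2 * A^3 - 3 * A^2 + 5 * A - 2) * P * Q^2"
  \<comment> \<open>With \<open>w * D = 1\<close> every term becomes \<open>w^3\<close> times a polynomial free of \<open>w\<close>.\<close>
  have "?L1 = w^3 * (- ((N11 * D - N * D11) * D - 2 * (N1 * D - N * D1) * D1)
    + 2 * ((N12 * D + N2 * D1 - N1 * D2 - N * D12) * D - 2 * (N2 * D - N * D2) * D1)
    + (N + H * D) * (N1 * D - N * D1) - 2 * (2 * H * D + N) * (N2 * D - N * D2)
    + H * N^2 * D + (2 * H^2 - h2) * N * D^2)"
    unfolding m m1 m2 m11 m12 using assms(1) D by algebra
  \<comment> \<open>Here \<open>w\<close> is a mere factor. Once all jets are in normal order, both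
    cofactors of \<open>w^3\<close> are the same polynomial in \<open>A\<close>, \<open>P\<close>,
    \<open>Q\<close>, \<open>H\<close>, \<open>h1\<close>, \<open>h2\<close> and the higher jets of
    \<open>a\<close>. The 1/3 in the coefficient of \<open>K\<close> stems from symmetrization: the
    first summand of \<open>a112\<close> exceeds each of the other two by \<open>K * P\<close>, and
    the last summand of \<open>a122\<close> falls short of the other two by
    \<open>K * Q\<close>.\<close>
  also have "\<dots> = w^3 * (D^2 * ?X + D * ?Y + ?Z)"
    unfolding a111 a112 a122 a11 a12 a22 N N1 N2 N11 N12 D1 D2 D11 D12 T1 Q11 Q12 S1 Q1 D assms(2)
    by algebra
  \<comment> \<open>\<open>w^3 * D^2 = w\<close> and \<open>w^3 * D = w^2\<close> restore the three
    denominators.\<close>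
  also have "\<dots> = w * ?X + w^2 * ?Y + w^3 * ?Z"
    using assms(1) D by algebra
  finally show "?L1 = K1_rhs A K P Q a11 a12 a22 a111 a112 a122" by (simp only: K1_rhs_def W)
  have "?L2 = w^3 * (- ((N22 * D - N * D22) * D - 2 * (N2 * D - N * D2) * D2)
    + 2 * ((N12 * D + N2 * D1 - N1 * D2 - N * D12) * D - 2 * (N2 * D - N * D2) * D1)
    + 2 * (N - H * D) * (N1 * D - N * D1) - (H * D + N) * (N2 * D - N * D2)
    - H * N^2 * D + (2 * H^2 - h1) * N * D^2)"
    unfolding m m1 m2 m22 m12 using assms(1) D by algebra
  also have "\<dots> = w^3 * (D^2 * ?X' + D * ?Y' + ?Z')"
    unfolding a222 a112 a122 a11 a12 a22 N N1 N2 N22 N12 D1 D2 D22 D12 T1 Q11 Q12 S1 Q1 D assms(2)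
    by algebra
  also have "\<dots> = w * ?X' + w^2 * ?Y' + w^3 * ?Z'"
    using assms(1) D by algebra
  finally show "?L2 = K2_rhs A K P Q a11 a12 a22 a112 a122 a222" by (simp only: K2_rhs_def W)
qed

section \<open>Derivations of the web\<close>

text \<open>Carries the hypotheses on \<open>f\<close> only, so that the rules for
  \<open>web_pd\<close> apply to every smooth field: \<open>a\<close>, \<open>H\<close> and all
  their derivatives.\<close>

locale planar_web =
  fixes M :: "(real \<times> real) set" and f :: scalar_field
  assumes open_M: "open M"
    and smooth_f: "smooth_field f M"
    and pd_x_f_nonzero: "p \<in> M \<Longrightarrow> pd_x f p \<noteq> 0"
    and pd_y_f_nonzero: "p \<in> M \<Longrightarrow> pd_y f p \<noteq> 0"
begin

lemmas smooth_differentiable = smooth_field_differentiable[OF open_M]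

text \<open>The sign is the constant factor \<open>(-1)\<close>, to suit the closure rules for
  smooth fields; \<open>Suc 0\<close> is the form to which simp reduces the index 1.\<close>

lemma web_pd_eq:
  "web_pd f (Suc 0) u = (\<lambda>p. (-1) * (pd_x u p / pd_x f p))"
  "i \<noteq> Suc 0 \<Longrightarrow> web_pd f i u = (\<lambda>p. (-1) * (pd_y u p / pd_y f p))"
  by (auto simp: web_pd_def)

lemma smooth_web_pd: "smooth_field u M \<Longrightarrow> smooth_field (web_pd f i u) M"
  using smooth_f pd_x_f_nonzero pd_y_f_nonzero web_pd_eq(1)[of u] web_pd_eq(2)[of i u]
  by (cases "i = Suc 0")
    (simp_all only: smooth_field_mult smooth_field_const smooth_field_divide smooth_field_pd
      open_M not_False_eq_True)

lemma smooth_web_H: "smooth_field (web_H f) M"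
proof -
  have "web_H f = (\<lambda>p. pd_y (pd_x f) p / (pd_x f p * pd_y f p))"
    by (auto simp: web_H_def)
  then show ?thesis
    using pd_x_f_nonzero pd_y_f_nonzero
    by (auto intro!: smooth_field_divide smooth_field_mult smooth_field_pd smooth_f open_M)
qed

section \<open>Derivation rules for \<open>web_pd\<close> and the commutator\<close>

lemma web_pd_cong:
  "p \<in> M \<Longrightarrow> (\<And>q. q \<in> M \<Longrightarrow> u q
      = v q) \<Longrightarrow> web_pd f i u p = web_pd f i v p"
  using pd_cong[OF open_M, of p u v] by (simp add: web_pd_def)

lemma web_pd_add:
  "p \<in> M \<Longrightarrow> smooth_field u M \<Longrightarrow> smooth_field v M
      \<Longrightarrow>
    web_pd f i (\<lambda>q. u q + v q) p = web_pd f i u p + web_pd f i v p"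
  by (simp add: web_pd_def pd_add smooth_differentiable algebra_simps diff_divide_distrib
      add_divide_distrib)

lemma web_pd_diff:
  "p \<in> M \<Longrightarrow> smooth_field u M \<Longrightarrow> smooth_field v M
      \<Longrightarrow>
    web_pd f i (\<lambda>q. u q - v q) p = web_pd f i u p - web_pd f i v p"
  by (simp add: web_pd_def pd_diff smooth_differentiable algebra_simps diff_divide_distrib
      add_divide_distrib)

lemma web_pd_mult:
  "p \<in> M \<Longrightarrow> smooth_field u M \<Longrightarrow> smooth_field v M
      \<Longrightarrow>
    web_pd f i (\<lambda>q. u q * v q) p = web_pd f i u p * v p + u p * web_pd f i v p"
  by (simp add: web_pd_def pd_mult smooth_differentiable algebra_simps diff_divide_distrib
      add_divide_distrib)

lemma web_pd_divide:
  "p \<in> M \<Longrightarrow> smooth_field u M \<Longrightarrow> smooth_field v M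
      \<Longrightarrow> v p \<noteq> 0 \<Longrightarrow>
    web_pd f i (\<lambda>q. u q / v q) p = (web_pd f i u p * v p
      - u p * web_pd f i v p) / (v p)\<^sup>2"
  by (simp add: web_pd_def pd_divide smooth_differentiable diff_divide_distrib algebra_simps)

lemma web_pd_const: "web_pd f i (\<lambda>_. c) p = 0"
  by (simp add: web_pd_def pd_const)

text \<open>The second-order terms cancel by \<open>pd_commute\<close>. What remains comes from
  differentiating the coefficients 1/f_y along x and 1/f_x along y; both produce f_xy, and hence the
  common factor H.\<close>

lemma web_pd_commutator:
  assumes p: "p \<in> M" and u: "smooth_field u M"
  shows "web_pd f 1 (web_pd f 2 u) p
    = web_pd f 2 (web_pd f 1 u) p + web_H f p * (web_pd f 2 u p - web_pd f 1 u p)"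
proof -
  note [simp] = pd_x_f_nonzero[OF p] pd_y_f_nonzero[OF p]
  note s = smooth_field_pd smooth_f u
  have d: "pd_x u differentiable (at p)" "pd_y u differentiable (at p)"
    "pd_x f differentiable (at p)" "pd_y f differentiable (at p)"
    using s p by (auto intro: smooth_differentiable)
  then have q: "(\<lambda>q. pd_x u q / pd_x f q) differentiable (at p)"
    "(\<lambda>q. pd_y u q / pd_y f q) differentiable (at p)"
    by (auto intro: differentiable_divide)
  have "pd_x (web_pd f 2 u) p = pd_x (\<lambda>q. (-1) * (pd_y u q / pd_y f q)) p"
    by (subst web_pd_eq(2)) simp_all
  also have "\<dots> = - pd_x (\<lambda>q. pd_y u q / pd_y f q) p"
    by (subst pd_mult(1)[OF _ q(2)]) (simp_all add: pd_const)
  also have "\<dots> = - ((pd_x (pd_y u) p * pd_y f p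
      - pd_y u p * pd_x (pd_y f) p) / (pd_y f p)\<^sup>2)"
    by (subst pd_divide(1)[OF d(2,4)]) simp_all
  finally have x: "pd_x (web_pd f 2 u) p
    = - ((pd_x (pd_y u) p * pd_y f p - pd_y u p * pd_x (pd_y f) p) / (pd_y f p)\<^sup>2)" .
  have "pd_y (web_pd f 1 u) p = pd_y (\<lambda>q. (-1) * (pd_x u q / pd_x f q)) p"
    using web_pd_eq(1)[of u] by simp
  also have "\<dots> = - pd_y (\<lambda>q. pd_x u q / pd_x f q) p"
    by (subst pd_mult(2)[OF _ q(1)]) (simp_all add: pd_const)
  also have "\<dots> = - ((pd_y (pd_x u) p * pd_x f p
      - pd_x u p * pd_y (pd_x f) p) / (pd_x f p)\<^sup>2)"
    by (subst pd_divide(2)[OF d(1,3)]) simp_all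
  finally have y: "pd_y (web_pd f 1 u) p
    = - ((pd_y (pd_x u) p * pd_x f p - pd_x u p * pd_y (pd_x f) p) / (pd_x f p)\<^sup>2)" .
  have c: "pd_x (pd_y u) p = pd_y (pd_x u) p" "pd_x (pd_y f) p = pd_y (pd_x f) p"
    using pd_commute[OF open_M p] u smooth_f by auto
  show ?thesis
    unfolding web_pd_def[of f 1 "web_pd f 2 u"] web_pd_def[of f 2 "web_pd f 1 u"] x y c
    by (simp add: web_pd_def web_H_def field_simps power2_eq_square)
qed

section \<open>Covariant derivatives in terms of iterated derivations\<close>

lemma web_delta_eq: "web_delta f i k u = (\<lambda>p. web_pd f i u p - real k * web_H f p * u p)"
  by (auto simp: web_delta_def)

lemma web_delta_web_delta:
  assumes "p \<in> M" "smooth_field u M"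
  shows "web_delta f k 2 (web_delta f j 1 u) p =
    web_pd f k (web_pd f j u) p
    - (web_pd f k (web_H f) p * u p + web_H f p * web_pd f k u p)
    - 2 * web_H f p * (web_pd f j u p - web_H f p * u p)"
  using assms
  by (simp add: web_delta_eq web_pd_diff web_pd_mult smooth_web_pd smooth_web_H
      smooth_field_mult open_M)

lemma cov_eq:
  assumes "p \<in> M" "smooth_field a M"
  shows "cov1 f a i p = web_pd f i a p"
    and "cov2 f a i j p = web_pd f j (web_pd f i a) p - web_H f p * web_pd f i a p"
    and "cov3 f a i j k p =
      web_pd f k (web_pd f j (web_pd f i a)) p
      - (web_pd f k (web_H f) p * web_pd f i a p + web_H f p * web_pd f k (web_pd f i a) p)
      - 2 * web_H f p * (web_pd f j (web_pd f i a) p - web_H f p * web_pd f i a p)"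
proof -
  have e: "web_delta f i 0 a = web_pd f i a" by (simp add: web_delta_eq)
  show "cov1 f a i p = web_pd f i a p" by (simp add: cov1_def e)
  show "cov2 f a i j p = web_pd f j (web_pd f i a) p - web_H f p * web_pd f i a p"
    by (simp add: cov2_def e web_delta_eq)
  show "cov3 f a i j k p =
      web_pd f k (web_pd f j (web_pd f i a)) p
      - (web_pd f k (web_H f) p * web_pd f i a p + web_H f p * web_pd f k (web_pd f i a) p)
      - 2 * web_H f p * (web_pd f j (web_pd f i a) p - web_H f p * web_pd f i a p)"
    using web_delta_web_delta[OF assms(1) smooth_web_pd[OF assms(2)]] by (simp add: cov3_def e)
qed

text \<open>Quotient rule twice. The second application gives the denominator v^4, of which one
  factor cancels; the cube of \<open>1 / v p\<close> is the \<open>w^3\<close> of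
  \<open>web_identities\<close>.\<close>

lemma web_pd_web_pd_divide:
  assumes p: "p \<in> M" and u: "smooth_field u M" and v: "smooth_field v M"
    and nz: "\<And>q. q \<in> M \<Longrightarrow> v q \<noteq> 0"
  shows "web_pd f j (web_pd f i (\<lambda>q. u q / v q)) p = (1 / v p) ^ 3 *
    ((web_pd f j (web_pd f i u) p * v p + web_pd f i u p * web_pd f j v p
      - web_pd f j u p * web_pd f i v p - u p * web_pd f j (web_pd f i v) p) * v p
      - 2 * (web_pd f i u p * v p - u p * web_pd f i v p) * web_pd f j v p)"
proof -
  have "web_pd f j (web_pd f i (\<lambda>q. u q / v q)) p
      = web_pd f j (\<lambda>q. (web_pd f i u q * v q - u q * web_pd f i v q) / (v q * v q)) p"
    using web_pd_divide[OF _ u v] nz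
    by (intro web_pd_cong p) (simp add: power2_eq_square)
  also have "\<dots> = (1 / v p) ^ 3 *
    ((web_pd f j (web_pd f i u) p * v p + web_pd f i u p * web_pd f j v p
      - web_pd f j u p * web_pd f i v p - u p * web_pd f j (web_pd f i v) p) * v p
      - 2 * (web_pd f i u p * v p - u p * web_pd f i v p) * web_pd f j v p)"
    using nz[OF p] p u v
    by (simp add: web_pd_divide web_pd_diff web_pd_mult smooth_web_pd smooth_field_mult
        smooth_field_diff open_M) (simp add: field_simps power2_eq_square power3_eq_cube)
  finally show ?thesis .
qed

text \<open>\<open>web_identities\<close> leaves out the last two terms of each I_i. Together they
  are \<open>- cov_K f i p\<close>, since K is differentiated with weight 2.\<close>

lemma web_I_expansion:
  assumes p: "p \<in> M" and sa: "smooth_field a M"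
    and nz: "\<And>q. q \<in> M \<Longrightarrow> a q \<noteq> 0 \<and> a q \<noteq> 1"
  shows "web_I1_0 f a p =
      K1_rhs (a p) (web_K f p) (cov1 f a 1 p) (cov1 f a 2 p)
        (cov2 f a 1 1 p) (cov2 f a 1 2 p) (cov2 f a 2 2 p)
        (sym111 f a p) (sym112 f a p) (sym122 f a p) - cov_K f 1 p" (is "_ = ?R1 - _")
    and "web_I2_0 f a p =
      K2_rhs (a p) (web_K f p) (cov1 f a 1 p) (cov1 f a 2 p)
        (cov2 f a 1 1 p) (cov2 f a 1 2 p) (cov2 f a 2 2 p)
        (sym112 f a p) (sym122 f a p) (sym222 f a p) - cov_K f 2 p" (is "_ = ?R2 - _")
proof -
  define P where "P = web_pd f 1 a"
  define Q where "Q = web_pd f 2 a"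
  define N where "N = (\<lambda>q. P q - a q * Q q)"
  define D where "D = (\<lambda>q. a q - a q * a q)"
  define H where "H = web_H f"
  note sH = smooth_web_H[folded H_def]
  have sP: "smooth_field P M" and sQ: "smooth_field Q M"
    by (simp_all add: P_def Q_def smooth_web_pd sa)
  note smooth = sa sP sQ sH smooth_web_pd smooth_field_mult[OF open_M]
    smooth_field_diff[OF open_M] smooth_field_add[OF open_M] smooth_field_const
  have sN: "smooth_field N M" and sD: "smooth_field D M"
    by (simp_all add: N_def D_def smooth)
  have Dnz: "D q \<noteq> 0" if "q \<in> M" for q
    using nz[OF that] by (simp add: D_def algebra_simps)
  have mu: "web_mu0 f a = (\<lambda>q. N q / D q)"
    by (auto simp: web_mu0_def N_def D_def P_def Q_def power2_eq_square)
  define w where "w = 1 / D p"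
  have w: "w * (a p - (a p)\<^sup>2) = 1"
    using Dnz[OF p] by (simp add: w_def D_def power2_eq_square)
  have comm: "web_pd f 1 (web_pd f 2 u) q
    = web_pd f 2 (web_pd f 1 u) q + H q * (web_pd f 2 u q - web_pd f 1 u q)"
    if "smooth_field u M" "q \<in> M" for u q
    using web_pd_commutator[OF that(2,1)] by (simp add: H_def)
  have PQ: "web_pd f 1 Q q = web_pd f 2 P q + H q * (Q q - P q)" if "q \<in> M" for q
    using comm[OF sa that] by (simp add: P_def Q_def)
  \<comment> \<open>\<open>PQ\<close> is an equation on all of \<open>M\<close>, so both sides can
    be differentiated at \<open>p\<close>.\<close>
  have dPQ: "web_pd f i (web_pd f 1 Q) p = web_pd f i (web_pd f 2 P) p
      + web_pd f i H p * (Q p - P p) + H p * (web_pd f i Q p - web_pd f i P p)" for i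
  proof -
    have "web_pd f i (web_pd f 1 Q) p = web_pd f i (\<lambda>q. web_pd f 2 P q + H q * (Q q - P q)) p"
      by (intro web_pd_cong p PQ)
    then show ?thesis
      by (simp add: web_pd_add web_pd_mult web_pd_diff smooth p)
  qed
  have dN: "web_pd f i N q = web_pd f i P q - (web_pd f i a q * Q q + a q * web_pd f i Q q)"
    if "q \<in> M" for i q
    unfolding N_def by (simp add: web_pd_mult web_pd_diff smooth that)
  have dD: "web_pd f i D q = web_pd f i a q - 2 * a q * web_pd f i a q" if "q \<in> M" for i q
    unfolding D_def by (simp add: web_pd_mult web_pd_diff smooth that)
  have ddN: "web_pd f j (web_pd f i N) p = web_pd f j (web_pd f i P) p
      - (web_pd f j (web_pd f i a) p * Q p + web_pd f i a p * web_pd f j Q p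
        + web_pd f j a p * web_pd f i Q p + a p * web_pd f j (web_pd f i Q) p)" for i j
  proof -
    have "web_pd f j (web_pd f i N) p
        = web_pd f j (\<lambda>q. web_pd f i P q - (web_pd f i a q * Q q + a q * web_pd f i Q q)) p"
      by (intro web_pd_cong p dN)
    then show ?thesis
      by (simp add: web_pd_add web_pd_mult web_pd_diff smooth p)
  qed
  have ddD: "web_pd f j (web_pd f i D) p = web_pd f j (web_pd f i a) p
      - 2 * (web_pd f j a p * web_pd f i a p + a p * web_pd f j (web_pd f i a) p)" for i j
  proof -
    have "web_pd f j (web_pd f i D) p
        = web_pd f j (\<lambda>q. web_pd f i a q - 2 * a q * web_pd f i a q) p"
      by (intro web_pd_cong p dD)
    then show ?thesis
      by (simp add: web_pd_const web_pd_mult web_pd_diff smooth p)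
  qed
  have m: "web_pd f i (web_mu0 f a) p = w\<^sup>2 * (web_pd f i N p * D p
      - N p * web_pd f i D p)" for i
    using web_pd_divide[OF p sN sD Dnz[OF p], of i] by (simp add: mu w_def power_one_over)
  have mm: "web_pd f j (web_pd f i (web_mu0 f a)) p = w ^ 3 *
    ((web_pd f j (web_pd f i N) p * D p + web_pd f i N p * web_pd f j D p
      - web_pd f j N p * web_pd f i D p - N p * web_pd f j (web_pd f i D) p) * D p
      - 2 * (web_pd f i N p * D p - N p * web_pd f i D p) * web_pd f j D p)" for i j
    using web_pd_web_pd_divide[OF p sN sD Dnz, of j i] by (simp add: mu w_def)
  note cov = cov_eq[OF p sa, folded H_def]
  have K: "web_K f p = web_pd f 1 H p - web_pd f 2 H p" by (simp add: web_K_def H_def)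
  note P' = P_def[symmetric] Q_def[symmetric]
  have m0: "web_mu0 f a p = w * N p" by (simp add: mu w_def)
  have dD1: "web_pd f 1 D p = P p - 2 * a p * P p"
    by (simp only: dD[OF p] P')
  have dD2: "web_pd f 2 D p = Q p - 2 * a p * Q p"
    by (simp only: dD[OF p] P')
  have dD11: "web_pd f 1 (web_pd f 1 D) p = web_pd f 1 P p - 2 * (P p * P p
      + a p * web_pd f 1 P p)"
    by (simp only: ddD P')
  have dD12: "web_pd f 1 (web_pd f 2 D) p = web_pd f 1 Q p - 2 * (P p * Q p
      + a p * web_pd f 1 Q p)"
    by (simp only: ddD P')
  have dD22: "web_pd f 2 (web_pd f 2 D) p = web_pd f 2 Q p - 2 * (Q p * Q p
      + a p * web_pd f 2 Q p)"
    by (simp only: ddD P')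
  have dN1: "web_pd f 1 N p = web_pd f 1 P p - (P p * Q p + a p * web_pd f 1 Q p)"
    by (simp only: dN[OF p] P')
  have dN2: "web_pd f 2 N p = web_pd f 2 P p - (Q p * Q p + a p * web_pd f 2 Q p)"
    by (simp only: dN[OF p] P')
  have dN11: "web_pd f 1 (web_pd f 1 N) p = web_pd f 1 (web_pd f 1 P) p
      - (web_pd f 1 P p * Q p + 2 * P p * web_pd f 1 Q p + a p * web_pd f 1 (web_pd f 1 Q) p)"
    by (simp only: ddN P')
  have dN12: "web_pd f 1 (web_pd f 2 N) p = web_pd f 1 (web_pd f 2 P) p
      - (2 * Q p * web_pd f 1 Q p + P p * web_pd f 2 Q p + a p * web_pd f 1 (web_pd f 2 Q) p)"
    by (simp only: ddN P') (simp add: algebra_simps)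
  have dN22: "web_pd f 2 (web_pd f 2 N) p = web_pd f 2 (web_pd f 2 P) p
      - (3 * Q p * web_pd f 2 Q p + a p * web_pd f 2 (web_pd f 2 Q) p)"
    by (simp only: ddN P') (simp add: algebra_simps)
  \<comment> \<open>For equal indices the two cross terms of \<open>mm\<close> cancel.\<close>
  have m11: "web_pd f 1 (web_pd f 1 (web_mu0 f a)) p = w ^ 3
      * ((web_pd f 1 (web_pd f 1 N) p * D p - N p * web_pd f 1 (web_pd f 1 D) p) * D p - 2
      * (web_pd f 1 N p * D p - N p * web_pd f 1 D p) * web_pd f 1 D p)"
    using mm[of 1 1] by (simp add: algebra_simps)
  note m12 = mm[of 1 2]
  have m22: "web_pd f 2 (web_pd f 2 (web_mu0 f a)) p = w ^ 3
      * ((web_pd f 2 (web_pd f 2 N) p * D p - N p * web_pd f 2 (web_pd f 2 D) p) * D p - 2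
      * (web_pd f 2 N p * D p - N p * web_pd f 2 D p) * web_pd f 2 D p)"
    using mm[of 2 2] by (simp add: algebra_simps)
  have c11: "cov2 f a 1 1 p = web_pd f 1 P p - H p * P p"
    by (simp only: cov P')
  have c12: "cov2 f a 1 2 p = web_pd f 2 P p - H p * P p"
    by (simp only: cov P')
  have c22: "cov2 f a 2 2 p = web_pd f 2 Q p - H p * Q p"
    by (simp only: cov P')
  have c111: "sym111 f a p = web_pd f 1 (web_pd f 1 P) p - (web_pd f 1 H p * P p
      + H p * web_pd f 1 P p) - 2 * H p * (web_pd f 1 P p - H p * P p)"
    by (simp only: sym111_def cov P')
  have c112: "sym112 f a p = 1 / 3 * ((web_pd f 2 (web_pd f 1 P) p - (web_pd f 2 H p * P p
      + H p * web_pd f 2 P p) - 2 * H p * (web_pd f 1 P p - H p * P p))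
      + (web_pd f 1 (web_pd f 2 P) p - (web_pd f 1 H p * P p + H p * web_pd f 1 P p)
      - 2 * H p * (web_pd f 2 P p - H p * P p))
      + (web_pd f 1 (web_pd f 1 Q) p - (web_pd f 1 H p * Q p + H p * web_pd f 1 Q p)
      - 2 * H p * (web_pd f 1 Q p - H p * Q p)))"
    by (simp only: sym112_def cov P')
  have c122: "sym122 f a p = 1 / 3 * ((web_pd f 2 (web_pd f 2 P) p - (web_pd f 2 H p * P p
      + H p * web_pd f 2 P p) - 2 * H p * (web_pd f 2 P p - H p * P p))
      + (web_pd f 2 (web_pd f 1 Q) p - (web_pd f 2 H p * Q p + H p * web_pd f 2 Q p)
      - 2 * H p * (web_pd f 1 Q p - H p * Q p))
      + (web_pd f 1 (web_pd f 2 Q) p - (web_pd f 1 H p * Q p + H p * web_pd f 1 Q p)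
      - 2 * H p * (web_pd f 2 Q p - H p * Q p)))"
    by (simp only: sym122_def cov P')
  have c222: "sym222 f a p = web_pd f 2 (web_pd f 2 Q) p - (web_pd f 2 H p * Q p
      + H p * web_pd f 2 Q p) - 2 * H p * (web_pd f 2 Q p - H p * Q p)"
    by (simp only: sym222_def cov P')
  \<comment> \<open>The commutator equations bring the jets into normal order. The two open premises
    are the equations for \<open>D\<close> and \<open>N\<close>, supplied last; \<open>D\<close> was
    defined with \<open>a q * a q\<close> for the product rule and is folded back to a
    square.\<close>
  note ids = web_identities[OF w K PQ[OF p] comm[OF sP p] dPQ[of 1] dPQ[of 2] comm[OF sQ p] _ _
      dD1 dD2 dD11 dD12 dD22 dN1 dN2 dN11 dN12 dN22 m0 m[of 1] m[of 2]
      m11 m12 m22 c11 c12 c22 c111 c112 c122 c222,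
      OF fun_cong[OF D_def, of p, folded power2_eq_square] fun_cong[OF N_def, of p]]
  show "web_I1_0 f a p = ?R1 - cov_K f 1 p"
    using ids(1) by (simp add: web_I1_0_def web_I1_def cov_K_def web_delta_eq cov(1) P_def Q_def H_def)
  show "web_I2_0 f a p = ?R2 - cov_K f 2 p"
    using ids(2) by (simp add: web_I2_0_def web_I2_def cov_K_def web_delta_eq cov(1) P_def Q_def H_def)
qed

end

section \<open>The linearizability conditions as equations for the covariant derivatives of
  K\<close>

theorem mainTheorem3:
  fixes M :: "(real \<times> real) set"
    and f a :: "real \<times> real \<Rightarrow> real"
    and \<omega> :: "nat \<Rightarrow> real \<times> real \<Rightarrow> real \<times> real"
  assumes "open M" and "M \<noteq> {}" and "simply_connected M"
    and "smooth_field f M" and "smooth_field a M"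
    and "\<And>p. p \<in> M \<Longrightarrow> pd_x f p \<noteq> 0 \<and> pd_y f p \<noteq> 0"
    and "\<And>p. p \<in> M \<Longrightarrow> a p \<noteq> 0 \<and> a p \<noteq> 1"
    and "four_web \<omega> M"
    and "\<And>p. p \<in> M \<Longrightarrow> \<omega> 1 p = - pd_x f p *\<^sub>R form_dx p"
    and "\<And>p. p \<in> M \<Longrightarrow> \<omega> 2 p = - pd_y f p *\<^sub>R form_dy p"
    and "\<And>p. p \<in> M \<Longrightarrow> \<omega> 3 p = form_d f p"
    and "\<And>p. p \<in> M \<Longrightarrow> \<omega> 4 p = - (a p *\<^sub>R \<omega> 1 p + \<omega> 2 p)"
  shows "(\<forall>p\<in>M. web_I1_0 f a p = 0 \<and> web_I2_0 f a p = 0) \<longleftrightarrow>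
    (\<forall>p\<in>M.
      let A = a p; K = web_K f p;
          a1 = cov1 f a 1 p; a2 = cov1 f a 2 p;
          a11 = cov2 f a 1 1 p; a12 = cov2 f a 1 2 p; a22 = cov2 f a 2 2 p;
          a111 = sym111 f a p; a112 = sym112 f a p;
          a122 = sym122 f a p; a222 = sym222 f a p
      in
        cov_K f 1 p =
          1 / (A - A^2) *
            (1/3 * ((1 - A) * a1 + A * a2) * K - a111 + (2 + A) * a112 - 2 * A * a122)
          + 1 / (A - A^2)^2 *
            (((4 - 6 * A) * a1 + (A^2 + 3 * A - 2) * a2) * a11
             + ((2 * A^2 + 7 * A - 6) * a1 + (2 * A - 3 * A^2) * a2) * a12
             + (2 * (A - A^2) * a1 - 2 * A^2 * a2) * a22)
          + 1 / (A - A^2)^3 *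
            ((- 6 * A^2 + 8 * A - 3) * a1^3 - 2 * A^3 * a2^3
             + (2 * A^3 + 9 * A^2 - 15 * A + 6) * a1^2 * a2
             + (- 3 * A^3 + 6 * A^2 - 2 * A) * a1 * a2^2)
        \<and>
        cov_K f 2 p =
          1 / (A - A^2) *
            (1/3 * (a1 + (A - 1) * a2) * K + 2 * a112 - (2 * A + 1) * a122 + A * a222)
          + 1 / (A - A^2)^2 *
            ((2 * a1 + (2 * A - 2) * a2) * a11
             + ((6 * A - 5) * a1 + (- 2 * A^2 - 3 * A + 2) * a2) * a12
             + ((1 - A - 2 * A^2) * a1 + 2 * A^2 * a2) * a22)
          + 1 / (A - A^2)^3 *
            ((4 * A - 2) * a1^3 + A^3 * a2^3
             + (6 * A^2 - 12 * A + 5) * a1^2 * a2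
             + (- 2 * A^3 - 3 * A^2 + 5 * A - 2) * a1 * a2^2))"
proof -
  interpret planar_web M f
    using assms(1,4,6) by unfold_locales auto
  have "web_I1_0 f a p = 0 \<and> web_I2_0 f a p = 0 \<longleftrightarrow>
      cov_K f 1 p = K1_rhs (a p) (web_K f p) (cov1 f a 1 p) (cov1 f a 2 p)
        (cov2 f a 1 1 p) (cov2 f a 1 2 p) (cov2 f a 2 2 p)
        (sym111 f a p) (sym112 f a p) (sym122 f a p) \<and>
      cov_K f 2 p = K2_rhs (a p) (web_K f p) (cov1 f a 1 p) (cov1 f a 2 p)
        (cov2 f a 1 1 p) (cov2 f a 1 2 p) (cov2 f a 2 2 p)
        (sym112 f a p) (sym122 f a p) (sym222 f a p)" if "p \<in> M" for p
    using web_I_expansion[OF that assms(5,7)] by auto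
  then show ?thesis
    unfolding Let_def K1_rhs_def K2_rhs_def by (intro ball_cong refl)
qed

end
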